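(* Assume that the problem $$\min_{x\in\mathcal X}\ c^\top x+\sum_{d\in\mathcal D}\mathbb 1_d(x)\,\mathbb E_{\mathsf P_d}[Q(x,\xi)]\qquad(\mathrm{SP})$$ is feasible and bounded. Then the L-Shaped algorithm with distribution-specific cuts (described in the context) converges to an optimal solution of (SP) in a finite number of iterations.
   Context: Setting: $\mathcal X\subseteq\mathbb R^{n_1}$, $c\in\mathbb R^{n_1}$, $\mathcal D$ is finite, $(\mathcal X_d)_{d\in\mathcal D}$ is a partition of $\mathcal X$, $\mathbb 1_d$ is the characteristic function of $\mathcal X_d$. For each $d\in\mathcal D$, the distribution $\mathsf P_d$ of the random data is discrete with a finite set of scenarios $\mathcal S_d$, realizations $\xi_{sd}=(q_{sd},W_{sd},T_{sd},h_{sd})$ ($q_{sd}\in\mathbb R^{n_2}$, $W_{sd}\in\mathbb R^{m_2\times n_2}$, $T_{sd}\in\mathbb R^{m_2\times n_1}$, $h_{sd}\in\mathbb R^{m_2}$), and probabilities $\pi_{sd}$. Second stage (continuous): $Q(x,\xi)=\min_{y\ge0}\{q^\top y:Wy=h-Tx\}$ for $\xi=(q,W,T,h)$, equal to $+\infty$ if infeasible and $-\infty$ if unbounded; its dual is $\max\{\rho^\top(h-Tx):\rho^\top W\le q^\top\}$. Infeasibility under distributions other than the one enforced by $x$ is tolerated. $Q_d(x)=\mathbb E_{\mathsf P_d}[Q(x,\xi)]=\sum_{s\in\mathcal S_d}\pi_{sd}Q(x,\xi_{sd})$. $\mathcal K_{sd}=\{x\in\mathbb R^{n_1}:\exists y\ge0,\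 W_{sd}y=h_{sd}-T_{sd}x\}$, $\mathcal K_d=\bigcap_{s\in\mathcal S_d}\mathcal K_{sd}$. With $\mathbf 1=(1,\dots,1)^\top\in\mathbb R^{m_2}$, $$\Psi(x,\xi_{sd})=\min_{y\in\mathbb R_+^{n_2},\,w^+,w^-\in\mathbb R_+^{m_2}}\{\mathbf 1^\top w^++\mathbf 1^\top w^-:W_{sd}y+w^+-w^-=h_{sd}-T_{sd}x\},$$ whose dual is $\max\{\sigma^\top(h_{sd}-T_{sd}x):\sigma^\top W_{sd}\le0,\ -\mathbf 1\le\sigma\le\mathbf 1\}$. Standing assumptions: (i) for all $d\in\mathcal D$, $s\in\mathcal S_d$ there is a constant $U_{ds}<\infty$ with $U_{ds}\ge\max_{x\in\mathcal X}\Psi(x,\xi_{sd})$; (ii) there is a constant $U$ with $\infty>U\ge\max_{d\in\mathcal D}U_d-\min_{d\in\mathcal D}L_d$, where $U_d\ge\max_{x\in\mathcal X_d}Q_d(x)$ and $L_d\le\min_{x\in\mathcal X_d}Q_d(x)$. Cuts: let $F_d^s$ be the set of extreme points of $\{\sigma:\sigma^\top W_{sd}\le0,\ -\mathbf 1\le\sigma\le\mathbf 1\}$, $O_d^s$ the set of extreme points of $\{\rho:\rho^\top W_{sd}\le q_{sd}^\top\}$ and $O_d=\prod_{s\in\mathcal S_d}O_d^s$. The feasibility cuts for $d$ are $\sigma^\top(h_{sd}-T_{sd}x)\le U_{ds}(1-\mathbb 1_d(x))$, $s\in\mathcal S_d$, $\sigma\in F_d^s$; the optimality cuts for $d$ are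 $\mu\ge\sum_{s\in\mathcal S_d}\pi_{sd}\rho_s^\top(h_{sd}-T_{sd}x)-U(1-\mathbb 1_d(x))$, $(\rho_s)_{s\in\mathcal S_d}\in O_d$. Algorithm: cuts are added iteratively and never removed. At iteration $i$, solve the relaxed master problem, i.e. minimize $c^\top x+\mu$ over $x\in\mathcal X$ and $\mu$ subject to the cuts present so far, and let $(x^i,\mu^i)$ be its optimal solution (at the initial iterations, without a valid lower bound for $\mu$, it may be necessary to exclude $\mu$ from the optimization, setting $\mu^i=-\infty$, to prevent unboundedness). Identify $d^i\in\mathcal D$ with $x^i\in\mathcal X_{d^i}$. - If $x^i$ is second-stage infeasible, i.e. $x^i\notin\mathcal K_{d^i}$, add a feasibility cut for $d^i$ not yet present, generated from a scenario $s\in\mathcal S_{d^i}$ with $x^i\notin\mathcal K_{sd^i}$ and a $\sigma$ that is an optimal solution of the dual of $\Psi(x^i,\xi_{sd^i})$. - Otherwise, if $\mu^i<Q_{d^i}(x^i)$, add an optimality cut for $d^i$ not yet present, generated from $\rho_s$ that are optimal solutions of the duals of $Q(x^i,\xi_{sd^i})$, $s\in\mathcal S_{d^i}$. - Otherwise terminate.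
   Formalization: U_d must also bound the optimality-cut sums for d on X outside X_d; all π_sd > 0; existence of new cuts assumes nonempty dual polyhedra {ρ^T W ≤ q^T} have extreme points, and termination assumes this and that every relaxed master problem met has an optimal solution. *)

theory Defs
  imports "HOL-Analysis.Analysis"
begin

section \<open>Two-stage problems with decision-dependent distribution selection\<close>

text \<open>A realization \<open>\<xi> = (q, W, T, h)\<close> of the random data.\<close>

record ('n1::finite, 'n2::finite, 'm2::finite) realization =
  cost :: "real ^ 'n2"
  recourse :: "real ^ 'n2 ^ 'm2"
  tech :: "real ^ 'n1 ^ 'm2"
  rhs :: "real ^ 'm2"

record ('n1::finite, 'n2::finite, 'm2::finite, 'd, 's) sp =
  fs_set :: "(real ^ 'n1) set"
  fs_cost :: "real ^ 'n1"
  dists :: "'d set"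
  part :: "'d \<Rightarrow> (real ^ 'n1) set"
  scens :: "'d \<Rightarrow> 's set"
  prob :: "'d \<Rightarrow> 's \<Rightarrow> real"
  real_of_scen :: "'d \<Rightarrow> 's \<Rightarrow> ('n1, 'n2, 'm2) realization"

text \<open>Scenarios are the atoms of the distribution, so they have positive probability. The blocks
  of the partition are allowed to be empty.\<close>

definition sp_instance :: "('n1::finite, 'n2::finite, 'm2::finite, 'd, 's) sp \<Rightarrow> bool" where
  "sp_instance P \<longleftrightarrow>
     finite (dists P) \<and>
     (\<Union>d\<in>dists P. part P d) = fs_set P \<and> disjoint_family_on (part P) (dists P) \<and>
     (\<forall>d\<in>dists P. finite (scens P d) \<and> (\<forall>s\<in>scens P d. 0 < prob P d s) \<and>
        (\<Sum>s\<in>scens P d. prob P d s) = 1)"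

definition resid :: "('n1::finite, 'n2::finite, 'm2::finite) realization \<Rightarrow> real ^ 'n1 \<Rightarrow> real ^ 'm2" where
  "resid \<xi> x = rhs \<xi> - tech \<xi> *v x"

text \<open>The second-stage value: the infimum is \<open>\<infinity>\<close> for an infeasible program and \<open>-\<infinity>\<close> for an
  unbounded one; a feasible bounded linear program attains it.\<close>

definition Qval :: "real ^ 'n1 \<Rightarrow> ('n1::finite, 'n2::finite, 'm2::finite) realization \<Rightarrow> ereal" where
  "Qval x \<xi> = (INF y\<in>{y. 0 \<le> y \<and> recourse \<xi> *v y = resid \<xi> x}. ereal (cost \<xi> \<bullet> y))"

definition feas_val :: "real ^ 'n1 \<Rightarrow> ('n1::finite, 'n2::finite, 'm2::finite) realization \<Rightarrow> ereal" where
  "feas_val x \<xi> =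
     (INF (y, wp, wm)\<in>{(y, wp, wm). 0 \<le> y \<and> 0 \<le> wp \<and> 0 \<le> wm \<and>
                          recourse \<xi> *v y + wp - wm = resid \<xi> x}.
        ereal (1 \<bullet> wp + 1 \<bullet> wm))"

text \<open>In \<open>ereal\<close>, \<open>\<infinity> + (-\<infinity>) = \<infinity>\<close>: infeasibility in one scenario makes the expectation
  \<open>\<infinity>\<close>. Moreover \<open>0 * \<infinity> = 0\<close>, so only the distribution enforced by \<open>x\<close> enters the objective.\<close>

definition Qexp :: "('n1::finite, 'n2::finite, 'm2::finite, 'd, 's) sp \<Rightarrow> 'd \<Rightarrow> real ^ 'n1 \<Rightarrow> ereal" where
  "Qexp P d x = (\<Sum>s\<in>scens P d. ereal (prob P d s) * Qval x (real_of_scen P d s))"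

definition sp_obj :: "('n1::finite, 'n2::finite, 'm2::finite, 'd, 's) sp \<Rightarrow> real ^ 'n1 \<Rightarrow> ereal" where
  "sp_obj P x = ereal (fs_cost P \<bullet> x) + (\<Sum>d\<in>dists P. indicator (part P d) x * Qexp P d x)"

definition sp_feasible :: "('n1::finite, 'n2::finite, 'm2::finite, 'd, 's) sp \<Rightarrow> bool" where
  "sp_feasible P \<longleftrightarrow> (\<exists>x\<in>fs_set P. sp_obj P x < \<infinity>)"

definition sp_bounded :: "('n1::finite, 'n2::finite, 'm2::finite, 'd, 's) sp \<Rightarrow> bool" where
  "sp_bounded P \<longleftrightarrow> (INF x\<in>fs_set P. sp_obj P x) > -\<infinity>"

definition sp_optimal :: "('n1::finite, 'n2::finite, 'm2::finite, 'd, 's) sp \<Rightarrow> real ^ 'n1 \<Rightarrow> bool" where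
  "sp_optimal P x \<longleftrightarrow> is_arg_min (sp_obj P) (\<lambda>x. x \<in> fs_set P) x"

definition Kscen :: "('n1::finite, 'n2::finite, 'm2::finite) realization \<Rightarrow> (real ^ 'n1) set" where
  "Kscen \<xi> = {x. \<exists>y\<ge>0. recourse \<xi> *v y = resid \<xi> x}"

definition Kdist :: "('n1::finite, 'n2::finite, 'm2::finite, 'd, 's) sp \<Rightarrow> 'd \<Rightarrow> (real ^ 'n1) set" where
  "Kdist P d = (\<Inter>s\<in>scens P d. Kscen (real_of_scen P d s))"


section \<open>Dual polyhedra and cuts\<close>

definition feas_dual :: "('n1::finite, 'n2::finite, 'm2::finite) realization \<Rightarrow> (real ^ 'm2) set" where
  "feas_dual \<xi> = {\<sigma>. \<sigma> v* recourse \<xi> \<le> 0 \<and> - 1 \<le> \<sigma> \<and> \<sigma> \<le> 1}"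

definition opt_dual :: "('n1::finite, 'n2::finite, 'm2::finite) realization \<Rightarrow> (real ^ 'm2) set" where
  "opt_dual \<xi> = {\<rho>. \<rho> v* recourse \<xi> \<le> cost \<xi>}"

definition dual_optimal ::
  "(real ^ 'm2) set \<Rightarrow> ('n1::finite, 'n2::finite, 'm2::finite) realization \<Rightarrow> real ^ 'n1 \<Rightarrow> real ^ 'm2 \<Rightarrow> bool" where
  "dual_optimal D \<xi> x \<sigma> \<longleftrightarrow> is_arg_max (\<lambda>\<sigma>. \<sigma> \<bullet> resid \<xi> x) (\<lambda>\<sigma>. \<sigma> \<in> D) \<sigma>"

definition feas_vertices ::
  "('n1::finite, 'n2::finite, 'm2::finite, 'd, 's) sp \<Rightarrow> 'd \<Rightarrow> 's \<Rightarrow> (real ^ 'm2) set" where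
  "feas_vertices P d s = {\<sigma>. \<sigma> extreme_point_of feas_dual (real_of_scen P d s)}"

definition opt_vertices ::
  "('n1::finite, 'n2::finite, 'm2::finite, 'd, 's) sp \<Rightarrow> 'd \<Rightarrow> ('s \<Rightarrow> real ^ 'm2) set" where
  "opt_vertices P d =
     (\<Pi>\<^sub>E s\<in>scens P d. {\<rho>. \<rho> extreme_point_of opt_dual (real_of_scen P d s)})"

text \<open>The value \<open>\<Sum>s. \<pi>\<^sub>s (\<rho>\<^sub>s)\<^sup>T (h\<^sub>s - T\<^sub>s x)\<close> on which an optimality cut is built.\<close>

definition opt_cut_val ::
  "('n1::finite, 'n2::finite, 'm2::finite, 'd, 's) sp \<Rightarrow> 'd \<Rightarrow> ('s \<Rightarrow> real ^ 'm2) \<Rightarrow> real ^ 'n1 \<Rightarrow> real" where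
  "opt_cut_val P d \<rho> x = (\<Sum>s\<in>scens P d. prob P d s * (\<rho> s \<bullet> resid (real_of_scen P d s) x))"

definition feas_cut ::
  "('n1::finite, 'n2::finite, 'm2::finite, 'd, 's) sp \<Rightarrow> ('d \<Rightarrow> 's \<Rightarrow> real) \<Rightarrow>
   'd \<times> 's \<times> (real ^ 'm2) \<Rightarrow> real ^ 'n1 \<Rightarrow> bool" where
  "feas_cut P Uf = (\<lambda>(d, s, \<sigma>) x.
     \<sigma> \<bullet> resid (real_of_scen P d s) x \<le> Uf d s * (1 - indicator (part P d) x))"

definition opt_cut ::
  "('n1::finite, 'n2::finite, 'm2::finite, 'd, 's) sp \<Rightarrow> real \<Rightarrow>
   'd \<times> ('s \<Rightarrow> (real ^ 'm2)) \<Rightarrow> real ^ 'n1 \<Rightarrow> real \<Rightarrow> bool" where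
  "opt_cut P U = (\<lambda>(d, \<rho>) x \<mu>.
     \<mu> \<ge> opt_cut_val P d \<rho> x - U * (1 - indicator (part P d) x))"


section \<open>Standing assumptions on the big-M constants\<close>

definition feas_bigM ::
  "('n1::finite, 'n2::finite, 'm2::finite, 'd, 's) sp \<Rightarrow> ('d \<Rightarrow> 's \<Rightarrow> real) \<Rightarrow> bool" where
  "feas_bigM P Uf \<longleftrightarrow>
     (\<forall>d\<in>dists P. \<forall>s\<in>scens P d. \<forall>x\<in>fs_set P. feas_val x (real_of_scen P d s) \<le> ereal (Uf d s))"

text \<open>The upper bound \<open>Ud d\<close> on \<open>part P d\<close> is required at second-stage feasible points only, since
  \<open>Qexp P d\<close> is \<open>\<infinity>\<close> at the others. The second condition on \<open>Ud d\<close> concerns the points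
  outside \<open>part P d\<close>. There \<open>Qexp P d\<close> may be \<open>\<infinity>\<close>, so the bound is put on the dual vertex values,
  which never exceed \<open>Qexp P d\<close>. It cannot be dropped: bounds on the blocks \<open>part P d\<close>
  alone do not keep a cut for \<open>d\<close> from cutting off optimal points of another block.\<close>

definition opt_bigM ::
  "('n1::finite, 'n2::finite, 'm2::finite, 'd, 's) sp \<Rightarrow> real \<Rightarrow> bool" where
  "opt_bigM P U \<longleftrightarrow> (\<exists>Ud Ld :: 'd \<Rightarrow> real.
     (\<forall>d\<in>dists P. \<forall>x\<in>part P d \<inter> Kdist P d. Qexp P d x \<le> ereal (Ud d)) \<and>
     (\<forall>d\<in>dists P. \<forall>x\<in>fs_set P - part P d. \<forall>\<rho>\<in>opt_vertices P d. opt_cut_val P d \<rho> x \<le> Ud d) \<and>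
     (\<forall>d\<in>dists P. \<forall>x\<in>part P d. ereal (Ld d) \<le> Qexp P d x) \<and>
     Max (Ud ` dists P) - Min (Ld ` dists P) \<le> U)"


section \<open>The L-shaped algorithm\<close>

text \<open>The cuts present: labels of feasibility cuts and labels of optimality cuts.\<close>

type_synonym ('m2, 'd, 's) cuts =
  "('d \<times> 's \<times> (real ^ 'm2)) set \<times> ('d \<times> ('s \<Rightarrow> (real ^ 'm2))) set"

text \<open>As long as there is no optimality cut, nothing bounds \<open>\<mu>\<close> from below; it is then left out of
  the master problem and set to \<open>-\<infinity>\<close>.\<close>

definition master_sol ::
  "('n1::finite, 'n2::finite, 'm2::finite, 'd, 's) sp \<Rightarrow> ('d \<Rightarrow> 's \<Rightarrow> real) \<Rightarrow> real \<Rightarrow>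
   ('m2, 'd, 's) cuts \<Rightarrow> real ^ 'n1 \<Rightarrow> ereal \<Rightarrow> bool" where
  "master_sol P Uf U C x \<mu> \<longleftrightarrow>
     (if snd C = {} then
        \<mu> = -\<infinity> \<and>
        is_arg_min (\<lambda>x. fs_cost P \<bullet> x) (\<lambda>x. x \<in> fs_set P \<and> (\<forall>k\<in>fst C. feas_cut P Uf k x)) x
      else
        (\<exists>m. \<mu> = ereal m \<and>
           is_arg_min (\<lambda>(x, m). fs_cost P \<bullet> x + m)
             (\<lambda>(x, m). x \<in> fs_set P \<and> (\<forall>k\<in>fst C. feas_cut P Uf k x) \<and>
                       (\<forall>k\<in>snd C. opt_cut P U k x m)) (x, m)))"

inductive add_cut ::
  "('n1::finite, 'n2::finite, 'm2::finite, 'd, 's) sp \<Rightarrow>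
   ('m2, 'd, 's) cuts \<Rightarrow> real ^ 'n1 \<Rightarrow> ereal \<Rightarrow> ('m2, 'd, 's) cuts \<Rightarrow> bool" for P where
  feasibility:
    "\<lbrakk>d \<in> dists P; x \<in> part P d; x \<notin> Kdist P d;
      s \<in> scens P d; x \<notin> Kscen (real_of_scen P d s);
      \<sigma> \<in> feas_vertices P d s;
      dual_optimal (feas_dual (real_of_scen P d s)) (real_of_scen P d s) x \<sigma>;
      (d, s, \<sigma>) \<notin> F\<rbrakk>
     \<Longrightarrow> add_cut P (F, G) x \<mu> (insert (d, s, \<sigma>) F, G)"
| optimality:
    "\<lbrakk>d \<in> dists P; x \<in> part P d; x \<in> Kdist P d; \<mu> < Qexp P d x;
      \<rho> \<in> opt_vertices P d;
      \<forall>s\<in>scens P d. dual_optimal (opt_dual (real_of_scen P d s)) (real_of_scen P d s) x (\<rho> s);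
      (d, \<rho>) \<notin> G\<rbrakk>
     \<Longrightarrow> add_cut P (F, G) x \<mu> (F, insert (d, \<rho>) G)"

definition stops ::
  "('n1::finite, 'n2::finite, 'm2::finite, 'd, 's) sp \<Rightarrow> real ^ 'n1 \<Rightarrow> ereal \<Rightarrow> bool" where
  "stops P x \<mu> \<longleftrightarrow> (\<exists>d\<in>dists P. x \<in> part P d \<and> x \<in> Kdist P d \<and> \<not> \<mu> < Qexp P d x)"

text \<open>\<open>iterations P Uf U n C x \<mu>\<close>: starting without cuts, iterations \<open>0, \<dots>, n - 1\<close> solve the master
  problem and add a cut; \<open>C n\<close> are the cuts available to iteration \<open>n\<close>.\<close>

definition iterations ::
  "('n1::finite, 'n2::finite, 'm2::finite, 'd, 's) sp \<Rightarrow> ('d \<Rightarrow> 's \<Rightarrow> real) \<Rightarrow> real \<Rightarrow> nat \<Rightarrow>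
   (nat \<Rightarrow> ('m2, 'd, 's) cuts) \<Rightarrow> (nat \<Rightarrow> real ^ 'n1) \<Rightarrow> (nat \<Rightarrow> ereal) \<Rightarrow> bool" where
  "iterations P Uf U n C x \<mu> \<longleftrightarrow> C 0 = ({}, {}) \<and>
     (\<forall>i<n. master_sol P Uf U (C i) (x i) (\<mu> i) \<and> add_cut P (C i) (x i) (\<mu> i) (C (Suc i)))"

text \<open>What the algorithm takes for granted: the master problems it meets have optimal solutions, and
  a nonempty dual polyhedron has an extreme point.\<close>

definition masters_solvable ::
  "('n1::finite, 'n2::finite, 'm2::finite, 'd, 's) sp \<Rightarrow> ('d \<Rightarrow> 's \<Rightarrow> real) \<Rightarrow> real \<Rightarrow> bool" where
  "masters_solvable P Uf U \<longleftrightarrow>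
     (\<forall>n C x \<mu>. iterations P Uf U n C x \<mu> \<longrightarrow> (\<exists>x' \<mu>'. master_sol P Uf U (C n) x' \<mu>'))"

definition dual_pointed :: "('n1::finite, 'n2::finite, 'm2::finite, 'd, 's) sp \<Rightarrow> bool" where
  "dual_pointed P \<longleftrightarrow> (\<forall>d\<in>dists P. \<forall>s\<in>scens P d.
     opt_dual (real_of_scen P d s) \<noteq> {} \<longrightarrow> (\<exists>\<rho>. \<rho> extreme_point_of opt_dual (real_of_scen P d s)))"

end

theory Submission
  imports Defs
begin

text \<open>
  Finiteness and correctness rest on different facts.

  Every cut is labelled by vertices of the dual polyhedra. These polyhedra depend on the scenario but
  not on the first-stage decision, so there are finitely many labels (\<open>finite_labels\<close>); as each
  iteration adds a label that was not there before, the number of iterations is bounded.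

  Correctness says that the master problem stays a relaxation. A point \<open>z\<close> of finite cost, paired
  with its own second-stage value, satisfies every cut: cuts for the distribution that \<open>z\<close> enforces
  hold by weak duality, and the cuts for the other distributions are switched off by the big-M
  constants (\<open>feas_cut_valid\<close>, \<open>opt_cut_valid\<close>). Hence the optimal value of the master problem
  is a lower bound on the objective, and at termination the current point attains it
  (\<open>master_sol_stop_optimal\<close>).

  It remains to see that the algorithm cannot get stuck without terminating
  (\<open>new_cut_exists\<close>). The vertex that it looks for must exist and its cut must be new. A cut
  generated at the current master solution is violated there, because the dual optimum is positive
  when the second stage is infeasible (Farkas) and equals the second-stage value otherwise (strong
  duality); the cuts already present are satisfied there. That the dual optimum is attained at a vertex
  is a property of polyhedra, bounded or not, that have a vertex and on which the objective is bounded
  (\<open>pointed_polyhedron_vertex_maximum\<close>). Running the algorithm for as long as possible therefore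
  ends in a terminating iteration.
\<close>

section \<open>Linear optimization over pointed polyhedra\<close>

text \<open>Recession directions do not depend on the base point: the points of the segment from \<open>e\<close> to
  \<open>z + N w\<close> at fraction \<open>1 / N\<close> lie in \<open>D\<close> and converge to \<open>e + w\<close>.\<close>
lemma recession_direction_in_closed_convex:
  fixes D :: "'a::euclidean_space set"
  assumes "convex D" "closed D" "e \<in> D" and ray: "\<And>t. t \<ge> 0 \<Longrightarrow> z + t *\<^sub>R w \<in> D"
  shows "e + w \<in> D"
proof -
  let ?k = "\<lambda>n. inverse (real (Suc n))"
  let ?u = "\<lambda>n. e + w + ?k n *\<^sub>R (z - e)"
  have "?u n \<in> D" for n
  proof -
    have "(1 - ?k n) *\<^sub>R e + ?k n *\<^sub>R (z + real (Suc n) *\<^sub>R w) \<in> D"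
    proof (rule convexD[OF \<open>convex D\<close> \<open>e \<in> D\<close>])
      show "z + real (Suc n) *\<^sub>R w \<in> D" by (rule ray) simp
      have "?k n \<le> 1" by (simp add: inverse_le_1_iff)
      then show "0 \<le> 1 - ?k n" by linarith
    qed auto
    moreover have "(1 - ?k n) *\<^sub>R e + ?k n *\<^sub>R (z + real (Suc n) *\<^sub>R w) = ?u n"
      by (simp add: scaleR_diff_left scaleR_diff_right scaleR_add_right del: of_nat_Suc)
    ultimately show ?thesis by simp
  qed
  then have in_D: "\<forall>n. ?u n \<in> D" by blast
  have "?u \<longlonglongrightarrow> e + w + 0 *\<^sub>R (z - e)"
    by (intro tendsto_intros LIMSEQ_inverse_real_of_nat)
  from closed_sequentially[OF \<open>closed D\<close> in_D[rule_format] this]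
  have "e + w + 0 *\<^sub>R (z - e) \<in> D" .
  then show ?thesis by simp
qed

text \<open>A line in \<open>D\<close> can be translated to \<open>e\<close>, which is then the midpoint of \<open>e + w\<close> and
  \<open>e - w\<close>.\<close>
lemma extreme_point_no_line:
  fixes D :: "'a::euclidean_space set"
  assumes "convex D" "closed D" "e extreme_point_of D" and line: "\<And>t. z + t *\<^sub>R w \<in> D"
  shows "w = 0"
proof (rule ccontr)
  assume "w \<noteq> 0"
  have "e \<in> D" using assms by (auto simp: extreme_point_of_def)
  have "e + w \<in> D"
    using recession_direction_in_closed_convex[OF assms(1,2) \<open>e \<in> D\<close>] line by blast
  moreover have "z + t *\<^sub>R - w \<in> D" for t
    using line[of "- t"] by simp
  then have "e + - w \<in> D"
    using recession_direction_in_closed_convex[OF assms(1,2) \<open>e \<in> D\<close>] by blast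
  moreover have "e \<in> open_segment (e + w) (e + - w)"
  proof -
    have "e + w \<noteq> e + - w"
      using \<open>w \<noteq> 0\<close> by (simp add: eq_neg_iff_add_eq_0 flip: scaleR_2)
    moreover have "midpoint (e + w) (e + - w) = e"
      by (simp add: midpoint_def flip: scaleR_2)
    ultimately show ?thesis using midpoint_in_open_segment by metis
  qed
  ultimately show False
    using assms(3) by (auto simp: extreme_point_of_def)
qed

text \<open>Take a face of least dimension among those with a point \<open>z\<close> that is at least as good as
  \<open>x\<close>. Such points never lie on the relative boundary of this face, since a facet would be a smaller
  candidate. So a ray from \<open>z\<close> in the affine hull of the face cannot leave the face if the functional does
  not decrease along it.
  The functional being bounded, it is constant along every direction of the face, and every direction
  gives a whole line. As a polyhedron with a vertex contains no line, the face is a point.\<close>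
lemma pointed_polyhedron_vertex_dominates:
  fixes D :: "'a::euclidean_space set"
  assumes "polyhedron D" "e extreme_point_of D" "x \<in> D"
    and bounded: "\<And>z. z \<in> D \<Longrightarrow> c \<bullet> z \<le> b"
  obtains v where "v extreme_point_of D" "c \<bullet> x \<le> c \<bullet> v"
proof -
  have cD: "convex D" "closed D"
    using assms(1) polyhedron_imp_convex polyhedron_imp_closed by auto
  let ?good = "\<lambda>F. F face_of D \<and> (\<exists>z\<in>F. c \<bullet> x \<le> c \<bullet> z)"
  have "?good D" using \<open>x \<in> D\<close> cD face_of_refl by auto
  then obtain F where F: "?good F" and
    Fmin: "\<And>G. ?good G \<Longrightarrow> nat (aff_dim F + 1) \<le> nat (aff_dim G + 1)"
    using ex_has_least_nat[of ?good D "\<lambda>G. nat (aff_dim G + 1)"] by blast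
  then obtain z where z: "z \<in> F" "c \<bullet> x \<le> c \<bullet> z" by blast
  have polyF: "polyhedron F" using F assms(1) face_of_polyhedron_polyhedron by blast
  then have "closed F" by (rule polyhedron_imp_closed)
  have FD: "F \<subseteq> D" using F face_of_imp_subset by blast
  have interior: "y \<in> rel_interior F" if "y \<in> F" "c \<bullet> x \<le> c \<bullet> y" for y
  proof (rule ccontr)
    assume "y \<notin> rel_interior F"
    then have "y \<in> rel_frontier F"
      using \<open>y \<in> F\<close> closure_subset by (auto simp: rel_frontier_def)
    then obtain G where G: "G facet_of F" "y \<in> G"
      using rel_frontier_of_polyhedron[OF polyF] by blast
    then have "G face_of D" "aff_dim G = aff_dim F - 1" "aff_dim G \<ge> 0"
      using F face_of_trans aff_dim_geq[of G] aff_dim_empty[of G] by (auto simp: facet_of_def)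
    moreover from this have "nat (aff_dim F + 1) \<le> nat (aff_dim G + 1)"
      using Fmin[of G] G(2) \<open>c \<bullet> x \<le> c \<bullet> y\<close> by blast
    ultimately show False by linarith
  qed
  have ray: "z + t *\<^sub>R w \<in> F" if w: "z + w \<in> affine hull F" "c \<bullet> w \<ge> 0" and "t \<ge> 0" for w and t :: real
  proof -
    let ?f = "\<lambda>t. z + t *\<^sub>R w"
    let ?G = "{0..} \<inter> ?f -` F"
    have cont: "continuous_on {0..} ?f" by (intro continuous_intros)
    have up: "c \<bullet> x \<le> c \<bullet> ?f t" if "t \<ge> 0" for t
      using z w that by (simp add: algebra_simps add_increasing2)
    have "?f t \<in> affine hull F" for t
    proof -
      have "(1 - t) *\<^sub>R z + t *\<^sub>R (z + w) \<in> affine hull F"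
        using z w by (intro mem_affine) (auto simp: hull_inc)
      then show ?thesis by (simp add: algebra_simps)
    qed
    \<comment> \<open>The parameters \<open>t \<ge> 0\<close> for which the ray is in \<open>F\<close> form a closed set, and an open one
      because these points are in the relative interior.\<close>
    then have "openin (top_of_set {0..}) ({0..} \<inter> ?f -` rel_interior F)"
      by (intro continuous_openin_preimage[OF cont, of "affine hull F"] openin_rel_interior) auto
    moreover have "{0..} \<inter> ?f -` rel_interior F = ?G"
      using interior up rel_interior_subset by blast
    moreover have "closedin (top_of_set {0..}) ?G"
      by (rule continuous_closedin_preimage[OF cont \<open>closed F\<close>])
    moreover have "0 \<in> ?G" using z by simp
    ultimately have "?G = {0..}"
      using connected_clopen[of "{0::real..}"] connected_Ici[of "0::real"] by (metis empty_iff)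
    then show ?thesis using \<open>t \<ge> 0\<close> by auto
  qed
  have no_direction: "w = 0" if w: "z + w \<in> affine hull F" "c \<bullet> w \<ge> 0" for w
  proof -
    have "\<not> c \<bullet> w > 0"
    proof
      assume pos: "c \<bullet> w > 0"
      \<comment> \<open>Far enough on the ray for the functional to exceed \<open>b\<close>.\<close>
      define t where "t = (\<bar>b\<bar> + \<bar>c \<bullet> z\<bar> + 1) / (c \<bullet> w)"
      have "t \<ge> 0" using pos by (simp add: t_def)
      then have "c \<bullet> (z + t *\<^sub>R w) \<le> b" using ray[OF w] FD bounded by blast
      moreover have "t * (c \<bullet> w) = \<bar>b\<bar> + \<bar>c \<bullet> z\<bar> + 1" using pos by (simp add: t_def)
      ultimately show False by (simp add: inner_add_right)
    qed
    then have cw: "c \<bullet> w = 0" using w by simp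
    have "2 *\<^sub>R z + (- 1) *\<^sub>R (z + w) \<in> affine hull F"
      using z w by (intro mem_affine) (auto simp: hull_inc)
    then have "z + - w \<in> affine hull F" by (simp add: algebra_simps scaleR_2)
    then have neg: "z + t *\<^sub>R - w \<in> F" if "t \<ge> 0" for t
      using ray[of "- w" t] cw that by simp
    have "z + t *\<^sub>R w \<in> D" for t
      using ray[OF w, of t] neg[of "- t"] FD by (cases "t \<ge> 0") auto
    then show "w = 0" using extreme_point_no_line[OF cD assms(2)] by blast
  qed
  have "y = z" if "y \<in> F" for y
  proof (cases "c \<bullet> (y - z) \<ge> 0")
    case True
    then show ?thesis using no_direction[of "y - z"] that by (simp add: hull_inc)
  next
    case False
    have "2 *\<^sub>R z + (- 1) *\<^sub>R y \<in> affine hull F"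
      using z that by (intro mem_affine) (auto simp: hull_inc)
    then have "z + (z - y) \<in> affine hull F" by (simp add: algebra_simps scaleR_2)
    then show ?thesis using no_direction[of "z - y"] False by (simp add: inner_diff_right)
  qed
  then have "F = {z}" using z(1) by blast
  then show thesis using F z(2) that[of z] by (simp add: face_of_singleton)
qed

lemma pointed_polyhedron_vertex_maximum:
  fixes D :: "'a::euclidean_space set"
  assumes "polyhedron D" "e extreme_point_of D"
    and bounded: "\<And>z. z \<in> D \<Longrightarrow> c \<bullet> z \<le> b"
  obtains v where "v extreme_point_of D" "\<And>z. z \<in> D \<Longrightarrow> c \<bullet> z \<le> c \<bullet> v"
proof -
  let ?V = "{v. v extreme_point_of D}"
  have fin: "finite ?V" using assms(1) by (rule finite_polyhedron_extreme_points)
  have "?V \<noteq> {}" using assms(2) by blast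
  with fin have "Max ((\<bullet>) c ` ?V) \<in> (\<bullet>) c ` ?V" by (intro Max_in) auto
  then obtain v where v: "v \<in> ?V" "Max ((\<bullet>) c ` ?V) = c \<bullet> v" by blast
  have v_max: "c \<bullet> u \<le> c \<bullet> v" if "u \<in> ?V" for u
    unfolding v(2)[symmetric] using fin that by (intro Max_ge) auto
  have "c \<bullet> z \<le> c \<bullet> v" if z: "z \<in> D" for z
  proof -
    obtain u where "u extreme_point_of D" "c \<bullet> z \<le> c \<bullet> u"
      using pointed_polyhedron_vertex_dominates[OF assms(1,2) z bounded] by blast
    then show ?thesis using v_max[of u] by simp
  qed
  then show thesis using v that by blast
qed

section \<open>Theorems of the alternative\<close>

text \<open>A finitely generated cone is closed, so a hyperplane separates it from \<open>p\<close>. Along a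
  generator on which \<open>a\<close> were negative, the functional would be unbounded below on the cone.\<close>
lemma convex_cone_hull_separation:
  fixes S :: "'a::euclidean_space set"
  assumes "finite S" "p \<notin> convex_cone hull S"
  obtains a where "a \<bullet> p < 0" "\<And>z. z \<in> S \<Longrightarrow> 0 \<le> a \<bullet> z"
proof -
  let ?K = "convex_cone hull S"
  obtain a b where ab: "a \<bullet> p < b" "\<And>z. z \<in> ?K \<Longrightarrow> a \<bullet> z > b"
    using separating_hyperplane_closed_point[OF convex_convex_cone_hull
        closed_convex_cone_hull[OF assms(1)] assms(2)] by auto
  have "b < 0" using ab(2)[OF convex_cone_hull_contains_0] by simp
  moreover have "0 \<le> a \<bullet> z" if "z \<in> S" for z
  proof (rule ccontr)
    assume neg: "\<not> 0 \<le> a \<bullet> z"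
    have "(b / (a \<bullet> z)) *\<^sub>R z \<in> ?K"
      using that neg \<open>b < 0\<close> by (intro convex_cone_hull_mul) (auto simp: hull_inc divide_nonpos_nonpos)
    then show False using ab(2) neg by fastforce
  qed
  moreover have "a \<bullet> p < 0" using ab(1) \<open>b < 0\<close> by linarith
  ultimately show thesis using that by blast
qed

lemma convex_cone_nonneg: "convex_cone {y :: real ^ 'n. 0 \<le> y}"
  unfolding convex_cone_iff by (auto simp: less_eq_vec_def)

lemma convex_cone_nonneg_real: "convex_cone {0::real..}"
  unfolding convex_cone_iff by auto

lemma axis_nonneg: "0 \<le> (axis i 1 :: real ^ 'n)"
  by (simp add: less_eq_vec_def axis_def)

lemma inner_nonneg_vec:
  fixes a b :: "real ^ 'n"
  shows "0 \<le> a \<Longrightarrow> 0 \<le> b \<Longrightarrow> 0 \<le> a \<bullet> b"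
  by (simp add: inner_vec_def less_eq_vec_def sum_nonneg)

lemma inner_mono_vec:
  fixes a b y :: "real ^ 'n"
  shows "a \<le> b \<Longrightarrow> 0 \<le> y \<Longrightarrow> a \<bullet> y \<le> b \<bullet> y"
  using inner_nonneg_vec[of "b - a" y] by (simp add: inner_diff_left less_eq_vec_def)

lemma vector_matrix_mult_component:
  fixes a :: "real ^ 'm"
  shows "(a v* W) $ j = a \<bullet> column j W"
  by (simp add: vector_matrix_mult_def inner_vec_def column_def mult.commute)

text \<open>Strong duality for a feasible primal, in a form that also covers an infeasible dual: every \<open>v\<close>
  that bounds the dual values from above is met by a primal solution, and any \<open>v\<close> is such a bound
  if there is no dual solution. The claim says that \<open>(r, v)\<close> is in the cone of the pairs
  \<open>(W y, q \<bullet> y + t)\<close> with \<open>y, t \<ge> 0\<close>. A functional \<open>(a, b)\<close> separating it from the cone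
  would give the dual solution \<open>- a / b\<close> of value above \<open>v\<close> if \<open>b > 0\<close>, and a certificate of
  primal infeasibility if \<open>b = 0\<close>.\<close>
lemma dual_bound_attained:
  fixes W :: "real ^ 'n ^ 'm"
  assumes y0: "0 \<le> y0" "W *v y0 = r"
    and bound: "\<And>\<rho>. \<rho> v* W \<le> q \<Longrightarrow> \<rho> \<bullet> r \<le> v"
  obtains y where "0 \<le> y" "W *v y = r" "q \<bullet> y \<le> v"
proof -
  define S where "S = insert (0::real^'m, 1::real) (range (\<lambda>j. (column j W, q $ j)))"
  let ?f = "\<lambda>(y, t). (W *v y, q \<bullet> y + t)"
  let ?C = "?f ` ({y. 0 \<le> y} \<times> {0..})"
  have "(r, v) \<in> convex_cone hull S"
  proof (rule ccontr)
    assume "(r, v) \<notin> convex_cone hull S"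
    then obtain ab where ab: "ab \<bullet> (r, v) < 0" "\<And>z. z \<in> S \<Longrightarrow> 0 \<le> ab \<bullet> z"
      using convex_cone_hull_separation[of S "(r, v)"] by (auto simp: S_def)
    obtain a b where "ab = (a, b)" by fastforce
    with ab have sep: "a \<bullet> r + b * v < 0" and "0 \<le> b"
      and cols: "\<And>j. 0 \<le> a \<bullet> column j W + b * q $ j"
      using ab(2)[of "(0, 1)"] ab(2)[of "(column j W, q $ j)" for j] by (auto simp: S_def)
    show False
    proof (cases "b = 0")
      case True
      then have "0 \<le> a v* W" using cols by (simp add: less_eq_vec_def vector_matrix_mult_component)
      then have "0 \<le> (a v* W) \<bullet> y0" using y0 inner_nonneg_vec by blast
      then show False using sep True y0 by (simp add: dot_lmul_matrix)
    next
      case False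
      then have "0 < b" using \<open>0 \<le> b\<close> by simp
      have "((- 1 / b) *\<^sub>R a) v* W \<le> q"
        unfolding less_eq_vec_def
      proof
        fix j
        show "((- 1 / b) *\<^sub>R a v* W) $ j \<le> q $ j"
          unfolding scaleR_vector_matrix_assoc vector_scaleR_component vector_matrix_mult_component
          using cols[of j] \<open>0 < b\<close> by (simp add: field_simps)
      qed
      from bound[OF this] show False using sep \<open>0 < b\<close> by (simp add: field_simps)
    qed
  qed
  moreover have "convex_cone hull S \<subseteq> ?C"
  proof (rule hull_minimal)
    show "S \<subseteq> ?C"
    proof -
      have "?f (0, 1) \<in> ?C" by (rule imageI) simp
      moreover have "?f (axis j 1, 0) \<in> ?C" for j
        by (rule imageI) (simp add: axis_nonneg)
      ultimately show ?thesis
        by (auto simp: S_def matrix_vector_mult_basis cart_eq_inner_axis)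
    qed
    have "linear ?f"
      by (rule linearI) (auto simp: algebra_simps)
    then show "convex_cone ?C"
      by (intro convex_cone_linear_image conjI convex_cone_Times convex_cone_nonneg convex_cone_nonneg_real)
  qed
  ultimately have "(r, v) \<in> ?C" by (rule subsetD[rotated])
  then obtain y t where "0 \<le> y" "(0::real) \<le> t" "r = W *v y" "v = q \<bullet> y + t"
    by auto
  then show thesis using that[of y] by simp
qed

text \<open>If \<open>r\<close> is not in the cone generated by the columns of \<open>W\<close>, the negative of a separating
  functional is the certificate.\<close>
lemma farkas:
  fixes W :: "real ^ 'n ^ 'm"
  assumes "\<not> (\<exists>y\<ge>0. W *v y = r)"
  obtains \<sigma> where "\<sigma> v* W \<le> 0" "0 < \<sigma> \<bullet> r"
proof -
  define S where "S = range (\<lambda>j. column j W)"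
  let ?C = "(*v) W ` {y. 0 \<le> y}"
  have "convex_cone hull S \<subseteq> ?C"
  proof (rule hull_minimal)
    show "S \<subseteq> ?C"
      using axis_nonneg by (auto simp: S_def simp flip: matrix_vector_mult_basis)
    show "convex_cone ?C"
      by (intro convex_cone_linear_image conjI convex_cone_nonneg matrix_vector_mul_linear)
  qed
  then have "r \<notin> convex_cone hull S" using assms by blast
  then obtain a where a: "a \<bullet> r < 0" "\<And>z. z \<in> S \<Longrightarrow> 0 \<le> a \<bullet> z"
    using convex_cone_hull_separation[of S r] by (auto simp: S_def)
  have "(- a) v* W \<le> 0"
    using a(2) by (simp add: S_def less_eq_vec_def vector_matrix_mult_component)
  then show thesis using that a(1) by fastforce
qed

section \<open>Second-stage duality\<close>

lemma polyhedron_vector_matrix_le: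
  fixes W :: "real ^ 'n ^ 'm"
  shows "polyhedron {\<rho>. \<rho> v* W \<le> q}"
proof -
  have "{\<rho>. \<rho> v* W \<le> q} = (\<Inter>j. {\<rho>. column j W \<bullet> \<rho> \<le> q $ j})"
    by (auto simp: less_eq_vec_def vector_matrix_mult_component inner_commute)
  then show ?thesis
    by (auto intro!: polyhedron_Inter polyhedron_halfspace_le)
qed

lemma polyhedron_opt_dual: "polyhedron (opt_dual \<xi>)"
  unfolding opt_dual_def by (rule polyhedron_vector_matrix_le)

lemma feas_dual_eq: "feas_dual \<xi> = {\<sigma>. \<sigma> v* recourse \<xi> \<le> 0} \<inter> cbox (- 1) 1"
  by (auto simp: feas_dual_def interval_cbox_cart[symmetric])

lemma polyhedron_feas_dual: "polyhedron (feas_dual \<xi>)"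
  unfolding feas_dual_eq by (intro polyhedron_Int polyhedron_vector_matrix_le polyhedron_interval)

lemma feas_dual_has_vertex: "\<exists>\<sigma>. \<sigma> extreme_point_of feas_dual \<xi>"
proof -
  have "compact (feas_dual \<xi>)"
    unfolding feas_dual_eq
    by (intro closed_Int_compact compact_cbox polyhedron_imp_closed polyhedron_vector_matrix_le)
  moreover have "0 \<in> feas_dual \<xi>" by (simp add: feas_dual_def less_eq_vec_def)
  ultimately show ?thesis
    using extreme_point_exists_convex polyhedron_imp_convex[OF polyhedron_feas_dual] by blast
qed

text \<open>The constraint \<open>\<sigma> v* W \<le> 0\<close> of the feasibility dual is the case \<open>q = 0\<close>.\<close>
lemma weak_duality:
  fixes W :: "real ^ 'n ^ 'm"
  assumes "\<rho> v* W \<le> q" "0 \<le> y"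
  shows "\<rho> \<bullet> (W *v y) \<le> q \<bullet> y"
  using inner_mono_vec[OF assms] by (simp add: dot_lmul_matrix)

lemma opt_dual_le_Qval:
  assumes "\<rho> \<in> opt_dual \<xi>"
  shows "ereal (\<rho> \<bullet> resid \<xi> x) \<le> Qval x \<xi>"
  unfolding Qval_def
proof (rule INF_greatest)
  fix y assume "y \<in> {y. 0 \<le> y \<and> recourse \<xi> *v y = resid \<xi> x}"
  then show "ereal (\<rho> \<bullet> resid \<xi> x) \<le> ereal (cost \<xi> \<bullet> y)"
    using weak_duality[of \<rho> "recourse \<xi>" "cost \<xi>" y] assms by (simp add: opt_dual_def)
qed

lemma feas_dual_le_feas_val:
  assumes "\<sigma> \<in> feas_dual \<xi>"
  shows "ereal (\<sigma> \<bullet> resid \<xi> x) \<le> feas_val x \<xi>"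
  unfolding feas_val_def
proof (rule INF_greatest, clarify)
  fix y wp wm
  assume y: "0 \<le> y" and w: "0 \<le> wp" "0 \<le> wm" and eq: "recourse \<xi> *v y + wp - wm = resid \<xi> x"
  have "\<sigma> \<bullet> (recourse \<xi> *v y) \<le> 0"
    using weak_duality[of \<sigma> "recourse \<xi>" 0 y] assms y by (simp add: feas_dual_def)
  moreover have "\<sigma> \<bullet> wp \<le> 1 \<bullet> wp" "(- 1) \<bullet> wm \<le> \<sigma> \<bullet> wm"
    using assms w unfolding feas_dual_def by (blast intro: inner_mono_vec)+
  moreover have "\<sigma> \<bullet> resid \<xi> x = \<sigma> \<bullet> (recourse \<xi> *v y) + \<sigma> \<bullet> wp - \<sigma> \<bullet> wm"
    by (simp add: eq[symmetric] inner_diff_right inner_add_right)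
  ultimately show "ereal (\<sigma> \<bullet> resid \<xi> x) \<le> ereal (1 \<bullet> wp + 1 \<bullet> wm)" by simp
qed

lemma feas_dual_nonpos:
  assumes "\<sigma> \<in> feas_dual \<xi>" "x \<in> Kscen \<xi>"
  shows "\<sigma> \<bullet> resid \<xi> x \<le> 0"
proof -
  obtain y where "0 \<le> y" "recourse \<xi> *v y = resid \<xi> x" using assms(2) by (auto simp: Kscen_def)
  then show ?thesis
    using weak_duality[of \<sigma> "recourse \<xi>" 0 y] assms(1) by (simp add: feas_dual_def)
qed

text \<open>A Farkas certificate of infeasibility, scaled into the unit box, is a point of the feasibility
  dual with a positive value, and so the optimal vertex has a positive value too.\<close>
lemma infeasible_feas_dual_vertex:
  fixes \<xi> :: "('n1::finite, 'n2::finite, 'm2::finite) realization"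
  assumes "x \<notin> Kscen \<xi>"
  obtains \<sigma> where "\<sigma> extreme_point_of feas_dual \<xi>" "dual_optimal (feas_dual \<xi>) \<xi> x \<sigma>"
    "0 < \<sigma> \<bullet> resid \<xi> x"
proof -
  obtain e where e: "e extreme_point_of feas_dual \<xi>" using feas_dual_has_vertex by blast
  have bound: "resid \<xi> x \<bullet> \<sigma> \<le> (\<Sum>i\<in>UNIV. \<bar>resid \<xi> x $ i\<bar>)" if "\<sigma> \<in> feas_dual \<xi>" for \<sigma>
  proof -
    have "\<bar>\<sigma> $ i\<bar> \<le> 1" for i
      using that by (auto simp: feas_dual_def less_eq_vec_def abs_le_iff minus_le_iff)
    then have "resid \<xi> x $ i * \<sigma> $ i \<le> \<bar>resid \<xi> x $ i\<bar>" for i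
      by (metis abs_ge_self abs_mult abs_ge_zero mult_left_le order_trans)
    then show ?thesis by (simp add: inner_vec_def sum_mono)
  qed
  obtain \<sigma> where \<sigma>: "\<sigma> extreme_point_of feas_dual \<xi>"
    "\<And>\<tau>. \<tau> \<in> feas_dual \<xi> \<Longrightarrow> resid \<xi> x \<bullet> \<tau> \<le> resid \<xi> x \<bullet> \<sigma>"
    using pointed_polyhedron_vertex_maximum[OF polyhedron_feas_dual e bound] by blast
  have "\<not> (\<exists>y\<ge>0. recourse \<xi> *v y = resid \<xi> x)" using assms by (auto simp: Kscen_def)
  then obtain \<tau> where \<tau>: "\<tau> v* recourse \<xi> \<le> 0" "0 < \<tau> \<bullet> resid \<xi> x" by (rule farkas)
  define k where "k = 1 / (1 + norm \<tau>)"
  have k: "0 < k" "k * norm \<tau> \<le> 1"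
    by (auto simp: k_def add_pos_nonneg divide_le_eq)
  have "\<bar>(k *\<^sub>R \<tau>) $ i\<bar> \<le> 1" for i
    using component_le_norm_cart[of "k *\<^sub>R \<tau>" i] k by simp
  then have box: "- 1 \<le> (k *\<^sub>R \<tau>) $ i" "(k *\<^sub>R \<tau>) $ i \<le> 1" for i
    by (meson abs_le_D1 abs_le_D2 minus_le_iff)+
  have "(k *\<^sub>R \<tau>) v* recourse \<xi> \<le> 0"
    using \<tau>(1) k(1) by (simp add: scaleR_vector_matrix_assoc less_eq_vec_def mult_nonneg_nonpos)
  then have "k *\<^sub>R \<tau> \<in> feas_dual \<xi>"
    using box by (simp add: feas_dual_def) (simp add: less_eq_vec_def)
  from \<sigma>(2)[OF this] have "0 < \<sigma> \<bullet> resid \<xi> x"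
    using \<tau>(2) k(1) by (simp add: inner_commute) (meson less_le_trans mult_pos_pos)
  moreover have "dual_optimal (feas_dual \<xi>) \<xi> x \<sigma>"
    using \<sigma> by (auto simp: dual_optimal_def is_arg_max_def extreme_point_of_def inner_commute not_less)
  ultimately show thesis using that \<sigma>(1) by blast
qed

text \<open>The hypothesis on \<open>Qval\<close> makes the dual feasible, because a feasible primal with an
  infeasible dual is unbounded; only then does a vertex exist.\<close>
lemma Qval_opt_dual_vertex:
  fixes \<xi> :: "('n1::finite, 'n2::finite, 'm2::finite) realization"
  assumes "x \<in> Kscen \<xi>" "Qval x \<xi> \<noteq> -\<infinity>"
    and pointed: "opt_dual \<xi> \<noteq> {} \<Longrightarrow> \<exists>\<rho>. \<rho> extreme_point_of opt_dual \<xi>"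
  obtains \<rho> where "\<rho> extreme_point_of opt_dual \<xi>" "dual_optimal (opt_dual \<xi>) \<xi> x \<rho>"
    "Qval x \<xi> = ereal (\<rho> \<bullet> resid \<xi> x)"
proof -
  obtain y0 where y0: "0 \<le> y0" "recourse \<xi> *v y0 = resid \<xi> x"
    using assms(1) by (auto simp: Kscen_def)
  have Qval_le: "Qval x \<xi> \<le> ereal v" if ub: "\<And>\<rho>. \<rho> \<in> opt_dual \<xi> \<Longrightarrow> \<rho> \<bullet> resid \<xi> x \<le> v" for v
  proof -
    have le: "\<rho> \<bullet> resid \<xi> x \<le> v" if "\<rho> v* recourse \<xi> \<le> cost \<xi>" for \<rho>
      using that by (intro ub) (simp add: opt_dual_def)
    obtain y where "0 \<le> y" "recourse \<xi> *v y = resid \<xi> x" "cost \<xi> \<bullet> y \<le> v"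
      by (rule dual_bound_attained[OF y0 le])
    then show ?thesis unfolding Qval_def by (intro INF_lower2[of y]) auto
  qed
  have "opt_dual \<xi> \<noteq> {}"
    using Qval_le ereal_bot[of "Qval x \<xi>"] assms(2) by auto
  then obtain e where e: "e extreme_point_of opt_dual \<xi>" using pointed by blast
  have "resid \<xi> x \<bullet> \<rho> \<le> cost \<xi> \<bullet> y0" if "\<rho> \<in> opt_dual \<xi>" for \<rho>
    using weak_duality[of \<rho> "recourse \<xi>" "cost \<xi>" y0] that y0
    by (simp add: opt_dual_def inner_commute)
  then obtain \<rho> where \<rho>: "\<rho> extreme_point_of opt_dual \<xi>"
    "\<And>\<tau>. \<tau> \<in> opt_dual \<xi> \<Longrightarrow> resid \<xi> x \<bullet> \<tau> \<le> resid \<xi> x \<bullet> \<rho>"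
    using pointed_polyhedron_vertex_maximum[OF polyhedron_opt_dual e] by blast
  then have "\<rho> \<in> opt_dual \<xi>" by (simp add: extreme_point_of_def)
  then have "Qval x \<xi> = ereal (\<rho> \<bullet> resid \<xi> x)"
    using \<rho>(2) by (intro antisym Qval_le opt_dual_le_Qval) (simp add: inner_commute)
  moreover have "dual_optimal (opt_dual \<xi>) \<xi> x \<rho>"
    using \<rho>(2) \<open>\<rho> \<in> opt_dual \<xi>\<close> by (auto simp: dual_optimal_def is_arg_max_def inner_commute not_less)
  ultimately show thesis using that \<rho>(1) by blast
qed

section \<open>Expected cost\<close>

lemma sp_obj_on_part:
  assumes "sp_instance P" "d \<in> dists P" "x \<in> part P d"
  shows "sp_obj P x = ereal (fs_cost P \<bullet> x) + Qexp P d x"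
proof -
  have "indicator (part P d') x * Qexp P d' x = 0" if "d' \<in> dists P - {d}" for d'
  proof -
    have "x \<notin> part P d'"
      using assms that by (auto simp: sp_instance_def disjoint_family_on_def)
    then show ?thesis by simp
  qed
  then have "(\<Sum>d'\<in>dists P - {d}. indicator (part P d') x * Qexp P d' x) = 0"
    by (rule sum.neutral[OF ballI])
  then have "(\<Sum>d'\<in>dists P. indicator (part P d') x * Qexp P d' x) = Qexp P d x"
    using assms by (subst sum.remove[of _ d]) (simp_all add: sp_instance_def)
  then show ?thesis by (simp add: sp_obj_def)
qed

lemma fs_set_part:
  assumes "sp_instance P"
  shows "x \<in> fs_set P \<longleftrightarrow> (\<exists>d\<in>dists P. x \<in> part P d)"
  using assms by (auto simp: sp_instance_def)

lemma Qexp_less_top_imp_Kdist: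
  assumes "sp_instance P" "d \<in> dists P" "Qexp P d x < \<infinity>"
  shows "x \<in> Kdist P d"
proof (rule ccontr)
  assume "x \<notin> Kdist P d"
  then obtain s where s: "s \<in> scens P d" "x \<notin> Kscen (real_of_scen P d s)"
    by (auto simp: Kdist_def)
  then have "{y. 0 \<le> y \<and> recourse (real_of_scen P d s) *v y = resid (real_of_scen P d s) x} = {}"
    by (auto simp: Kscen_def)
  then have "Qval x (real_of_scen P d s) = \<infinity>"
    unfolding Qval_def by (simp only: image_empty Inf_empty top_ereal_def)
  moreover have "0 < prob P d s" "finite (scens P d)"
    using assms s by (auto simp: sp_instance_def)
  ultimately have "Qexp P d x = \<infinity>"
    using s(1) unfolding Qexp_def sum_Pinfty by force
  then show False using assms(3) by simp
qed

lemma Qval_less_top: "x \<in> Kscen \<xi> \<Longrightarrow> Qval x \<xi> < \<infinity>"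
  unfolding Qval_def Kscen_def INF_less_iff by auto

text \<open>At a second-stage feasible point no summand of the expectation is \<open>\<infinity>\<close>, so a single
  \<open>-\<infinity>\<close> would not be absorbed.\<close>
lemma Qval_not_MInfty:
  assumes "sp_instance P" "d \<in> dists P" "x \<in> Kdist P d" "Qexp P d x \<noteq> -\<infinity>" "s \<in> scens P d"
  shows "Qval x (real_of_scen P d s) \<noteq> -\<infinity>"
proof
  let ?q = "\<lambda>s. ereal (prob P d s) * Qval x (real_of_scen P d s)"
  assume "Qval x (real_of_scen P d s) = -\<infinity>"
  moreover have pos: "\<And>s. s \<in> scens P d \<Longrightarrow> 0 < prob P d s" and fin: "finite (scens P d)"
    using assms by (auto simp: sp_instance_def)
  ultimately have "?q s = -\<infinity>" using pos[OF assms(5)] by simp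
  moreover have "?q t \<noteq> \<infinity>" if "t \<in> scens P d" for t
  proof -
    have "Qval x (real_of_scen P d t) \<noteq> \<infinity>"
      using Qval_less_top[of x] assms(3) that by (auto simp: Kdist_def)
    then show ?thesis using pos[OF that] by (cases "Qval x (real_of_scen P d t)") auto
  qed
  then have "(\<Sum>t\<in>scens P d - {s}. ?q t) \<noteq> \<infinity>"
    unfolding sum_Pinfty by blast
  moreover have "-\<infinity> + r = -\<infinity>" if "r \<noteq> \<infinity>" for r :: ereal
    using that by (cases r) auto
  ultimately have "Qexp P d x = -\<infinity>"
    unfolding Qexp_def sum.remove[OF fin assms(5)] by metis
  then show False using assms(4) by blast
qed

lemma opt_cut_val_le_Qexp:
  assumes "sp_instance P" "d \<in> dists P" "\<rho> \<in> opt_vertices P d"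
  shows "ereal (opt_cut_val P d \<rho> x) \<le> Qexp P d x"
proof -
  have "ereal (prob P d s * (\<rho> s \<bullet> resid (real_of_scen P d s) x))
      \<le> ereal (prob P d s) * Qval x (real_of_scen P d s)" if "s \<in> scens P d" for s
  proof -
    have "\<rho> s \<in> opt_dual (real_of_scen P d s)"
      using assms(3) that by (auto simp: opt_vertices_def extreme_point_of_def)
    moreover have "0 \<le> prob P d s" using assms that by (auto simp: sp_instance_def less_imp_le)
    ultimately show ?thesis
      using ereal_mult_left_mono[OF opt_dual_le_Qval] by (fastforce simp flip: times_ereal.simps(1))
  qed
  then show ?thesis
    by (simp only: opt_cut_val_def Qexp_def sum_ereal[symmetric]) (rule sum_mono)
qed

section \<open>Validity of the cuts\<close>

text \<open>On its own block a feasibility cut demands a nonpositive dual value, which is the case at every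
  second-stage feasible point; elsewhere \<open>Uf d s\<close> bounds the optimal value of the feasibility problem
  and thereby the dual value.\<close>
lemma feas_cut_valid:
  assumes "feas_bigM P Uf" "d \<in> dists P" "s \<in> scens P d" "\<sigma> \<in> feas_vertices P d s"
    and "x \<in> fs_set P" "x \<in> part P d \<Longrightarrow> x \<in> Kdist P d"
  shows "feas_cut P Uf (d, s, \<sigma>) x"
proof -
  have \<sigma>: "\<sigma> \<in> feas_dual (real_of_scen P d s)"
    using assms by (auto simp: feas_vertices_def extreme_point_of_def)
  show ?thesis
  proof (cases "x \<in> part P d")
    case True
    then have "x \<in> Kscen (real_of_scen P d s)" using assms by (auto simp: Kdist_def)
    then show ?thesis using feas_dual_nonpos[OF \<sigma>] True by (simp add: feas_cut_def)
  next
    case False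
    have "ereal (\<sigma> \<bullet> resid (real_of_scen P d s) x) \<le> ereal (Uf d s)"
      using feas_dual_le_feas_val[OF \<sigma>] assms by (meson feas_bigM_def order_trans)
    then show ?thesis using False by (simp add: feas_cut_def)
  qed
qed

text \<open>For \<open>d = d'\<close> this is weak duality. Otherwise the cut value is at most the largest \<open>Ud\<close>, and
  \<open>m\<close> is at least the smallest \<open>Ld\<close>; \<open>U\<close> is at least the difference of the two.\<close>
lemma opt_cut_valid:
  assumes "sp_instance P" "opt_bigM P U" "d \<in> dists P" "\<rho> \<in> opt_vertices P d"
    and "d' \<in> dists P" "x \<in> part P d'" "Qexp P d' x = ereal m"
  shows "opt_cut P U (d, \<rho>) x m"
proof (cases "x \<in> part P d")
  case True
  then have "d = d'"
    using assms by (auto simp: sp_instance_def disjoint_family_on_def)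
  then show ?thesis
    using opt_cut_val_le_Qexp[OF assms(1,3,4), of x] True assms(7) by (simp add: opt_cut_def)
next
  case False
  obtain Ud Ld where
    Ud: "\<forall>d\<in>dists P. \<forall>x\<in>fs_set P - part P d. \<forall>\<rho>\<in>opt_vertices P d. opt_cut_val P d \<rho> x \<le> Ud d" and
    Ld: "\<forall>d\<in>dists P. \<forall>x\<in>part P d. ereal (Ld d) \<le> Qexp P d x" and
    U: "Max (Ud ` dists P) - Min (Ld ` dists P) \<le> U"
    using assms(2) unfolding opt_bigM_def by blast
  have fin: "finite (dists P)" using assms(1) by (simp add: sp_instance_def)
  have "x \<in> fs_set P" using fs_set_part[OF assms(1)] assms by blast
  then have "opt_cut_val P d \<rho> x \<le> Ud d" using Ud False assms by blast
  also have "\<dots> \<le> Max (Ud ` dists P)" using fin assms by simp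
  finally have upper: "opt_cut_val P d \<rho> x \<le> Max (Ud ` dists P)" .
  have "Min (Ld ` dists P) \<le> Ld d'" using fin assms by simp
  also have "Ld d' \<le> m" using Ld assms by (metis ereal_less_eq(3))
  finally have lower: "Min (Ld ` dists P) \<le> m" .
  from upper lower U have "opt_cut_val P d \<rho> x - U \<le> m" by linarith
  then show ?thesis using False by (simp add: opt_cut_def)
qed

section \<open>Runs of the algorithm\<close>

definition feas_labels ::
  "('n1::finite, 'n2::finite, 'm2::finite, 'd, 's) sp \<Rightarrow> ('d \<times> 's \<times> (real ^ 'm2)) set" where
  "feas_labels P = (SIGMA d:dists P. SIGMA s:scens P d. feas_vertices P d s)"

definition opt_labels ::
  "('n1::finite, 'n2::finite, 'm2::finite, 'd, 's) sp \<Rightarrow> ('d \<times> ('s \<Rightarrow> real ^ 'm2)) set" where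
  "opt_labels P = (SIGMA d:dists P. opt_vertices P d)"

lemma finite_labels:
  assumes "sp_instance P"
  shows "finite (feas_labels P)" "finite (opt_labels P)"
  using assms unfolding feas_labels_def opt_labels_def feas_vertices_def opt_vertices_def sp_instance_def
  by (auto intro!: finite_SigmaI finite_PiE finite_polyhedron_extreme_points
      polyhedron_feas_dual polyhedron_opt_dual)

text \<open>As no iteration adds a label that is already present, the iterations can be counted by the
  labels in use; this is what bounds their number.\<close>
lemma iterations_cuts:
  assumes "sp_instance P" "iterations P Uf U n C x \<mu>" "i \<le> n"
  shows "fst (C i) \<subseteq> feas_labels P \<and> snd (C i) \<subseteq> opt_labels P \<and> card (fst (C i)) + card (snd (C i)) = i"
  using assms(3)
proof (induction i)
  case 0
  then show ?case using assms by (simp add: iterations_def)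
next
  case (Suc i)
  then have IH: "fst (C i) \<subseteq> feas_labels P" "snd (C i) \<subseteq> opt_labels P"
    "card (fst (C i)) + card (snd (C i)) = i" by auto
  have fin: "finite (fst (C i))" "finite (snd (C i))"
    using IH finite_labels[OF assms(1)] finite_subset by blast+
  have "add_cut P (C i) (x i) (\<mu> i) (C (Suc i))"
    using assms(2) Suc.prems by (simp add: iterations_def)
  then show ?case
  proof cases
    case feasibility
    then show ?thesis using IH fin by (auto simp: feas_labels_def)
  next
    case optimality
    then show ?thesis using IH fin by (auto simp: opt_labels_def)
  qed
qed

lemma iterations_bounded:
  assumes "sp_instance P" "iterations P Uf U n C x \<mu>"
  shows "n \<le> card (feas_labels P) + card (opt_labels P)"
proof -
  have "card (fst (C n)) \<le> card (feas_labels P)" "card (snd (C n)) \<le> card (opt_labels P)"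
    using iterations_cuts[OF assms order_refl] finite_labels[OF assms(1)] by (auto intro: card_mono)
  then show ?thesis using iterations_cuts[OF assms order_refl] by linarith
qed

lemma master_sol_feasible:
  assumes "master_sol P Uf U C x \<mu>"
  shows "x \<in> fs_set P" "\<And>k. k \<in> fst C \<Longrightarrow> feas_cut P Uf k x"
    "\<And>k. k \<in> snd C \<Longrightarrow> \<exists>m. \<mu> = ereal m \<and> opt_cut P U k x m"
  using assms by (auto simp: master_sol_def is_arg_min_def split: if_splits)

text \<open>Termination bounds the objective at \<open>x\<close> by the master value, and the master value is at most
  the objective at any \<open>z\<close> of finite cost, because \<open>z\<close> with its second-stage value satisfies all
  cuts.\<close>
lemma master_sol_stop_optimal:
  assumes inst: "sp_instance P" and big: "feas_bigM P Uf" "opt_bigM P U" and bounded: "sp_bounded P"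
    and labels: "fst C \<subseteq> feas_labels P" "snd C \<subseteq> opt_labels P"
    and sol: "master_sol P Uf U C x \<mu>" and stop: "stops P x \<mu>"
  shows "sp_optimal P x"
proof -
  obtain d where d: "d \<in> dists P" "x \<in> part P d" and le: "Qexp P d x \<le> \<mu>"
    using stop by (auto simp: stops_def not_less)
  have x: "x \<in> fs_set P" using master_sol_feasible[OF sol] by blast
  have obj: "sp_obj P x \<le> ereal (fs_cost P \<bullet> x) + \<mu>"
    using sp_obj_on_part[OF inst d] le by (simp add: add_left_mono)
  have below: "-\<infinity> < sp_obj P z" if "z \<in> fs_set P" for z
    using bounded that unfolding sp_bounded_def by (meson INF_lower less_le_trans)
  \<comment> \<open>Without optimality cuts \<open>\<mu>\<close> is \<open>-\<infinity>\<close>, and termination would mean that the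
    problem is unbounded.\<close>
  have "snd C \<noteq> {}"
  proof
    assume "snd C = {}"
    then have "\<mu> = -\<infinity>" using sol by (simp add: master_sol_def)
    then show False using obj below[OF x] by simp
  qed
  then obtain m where m: "\<mu> = ereal m" and
    min: "is_arg_min (\<lambda>(x, m). fs_cost P \<bullet> x + m)
       (\<lambda>(x, m). x \<in> fs_set P \<and> (\<forall>k\<in>fst C. feas_cut P Uf k x) \<and> (\<forall>k\<in>snd C. opt_cut P U k x m)) (x, m)"
    using sol by (auto simp: master_sol_def)
  have "sp_obj P x \<le> sp_obj P z" if z: "z \<in> fs_set P" for z
  proof (cases "sp_obj P z = \<infinity>")
    case False
    obtain e where e: "e \<in> dists P" "z \<in> part P e" using z fs_set_part[OF inst] by blast
    have objz: "sp_obj P z = ereal (fs_cost P \<bullet> z) + Qexp P e z" by (rule sp_obj_on_part[OF inst e])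
    then obtain v where v: "Qexp P e z = ereal v"
      using False below[OF z] by (cases "Qexp P e z") auto
    have Kz: "z \<in> Kdist P e" using Qexp_less_top_imp_Kdist[OF inst e(1)] v by simp
    have "feas_cut P Uf k z" if "k \<in> fst C" for k
    proof -
      obtain d' s \<sigma> where k: "k = (d', s, \<sigma>)" "d' \<in> dists P" "s \<in> scens P d'" "\<sigma> \<in> feas_vertices P d' s"
        using \<open>k \<in> fst C\<close> labels by (auto simp: feas_labels_def)
      have "z \<in> part P d' \<Longrightarrow> d' = e"
        using inst e k by (auto simp: sp_instance_def disjoint_family_on_def)
      then show ?thesis unfolding k(1) using feas_cut_valid[OF big(1) k(2-4) z] Kz by blast
    qed
    moreover have "opt_cut P U k z v" if "k \<in> snd C" for k
      using that labels opt_cut_valid[OF inst big(2) _ _ e v] by (auto simp: opt_labels_def)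
    ultimately have "fs_cost P \<bullet> x + m \<le> fs_cost P \<bullet> z + v"
      using min[unfolded is_arg_min_linorder, THEN conjunct2, rule_format, of "(z, v)"] z by simp
    then have "ereal (fs_cost P \<bullet> x) + \<mu> \<le> sp_obj P z" by (simp add: objz v m)
    then show ?thesis using obj by (rule order_trans[rotated])
  qed simp
  then show ?thesis using x by (auto simp: sp_optimal_def is_arg_min_def not_less)
qed

text \<open>The dual vertices found at \<open>x\<close> give a cut that \<open>(x, \<mu>)\<close> violates. As the
  solution of the master problem satisfies the cuts that are present, this one is not among them.\<close>
lemma new_cut_exists:
  assumes inst: "sp_instance P" and pointed: "dual_pointed P"
    and sol: "master_sol P Uf U C x \<mu>" and go: "\<not> stops P x \<mu>"
  shows "\<exists>C'. add_cut P C x \<mu> C'"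
proof -
  obtain F G where C: "C = (F, G)" by fastforce
  obtain d where d: "d \<in> dists P" "x \<in> part P d"
    using master_sol_feasible(1)[OF sol] fs_set_part[OF inst] by blast
  show ?thesis
  proof (cases "x \<in> Kdist P d")
    case False
    then obtain s where s: "s \<in> scens P d" "x \<notin> Kscen (real_of_scen P d s)"
      by (auto simp: Kdist_def)
    obtain \<sigma> where \<sigma>: "\<sigma> extreme_point_of feas_dual (real_of_scen P d s)"
      "dual_optimal (feas_dual (real_of_scen P d s)) (real_of_scen P d s) x \<sigma>"
      "0 < \<sigma> \<bullet> resid (real_of_scen P d s) x"
      using infeasible_feas_dual_vertex[OF s(2)] by blast
    have "(d, s, \<sigma>) \<notin> F"
      using master_sol_feasible(2)[OF sol, of "(d, s, \<sigma>)"] \<sigma>(3) d(2) by (auto simp: C feas_cut_def)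
    then show ?thesis
      unfolding C using add_cut.feasibility[OF d False s _ \<sigma>(2)] \<sigma>(1)
      unfolding feas_vertices_def by blast
  next
    case True
    have less: "\<mu> < Qexp P d x" using go d True by (auto simp: stops_def)
    let ?good = "\<lambda>s \<rho>. \<rho> extreme_point_of opt_dual (real_of_scen P d s) \<and>
      dual_optimal (opt_dual (real_of_scen P d s)) (real_of_scen P d s) x \<rho> \<and>
      Qval x (real_of_scen P d s) = ereal (\<rho> \<bullet> resid (real_of_scen P d s) x)"
    have "\<exists>\<rho>. ?good s \<rho>" if s: "s \<in> scens P d" for s
    proof -
      have "x \<in> Kscen (real_of_scen P d s)" using True s by (auto simp: Kdist_def)
      moreover have "Qval x (real_of_scen P d s) \<noteq> -\<infinity>"
        using less by (intro Qval_not_MInfty[OF inst d(1) True _ s]) auto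
      moreover have "opt_dual (real_of_scen P d s) \<noteq> {} \<Longrightarrow>
          \<exists>\<rho>. \<rho> extreme_point_of opt_dual (real_of_scen P d s)"
        using pointed d(1) s by (simp add: dual_pointed_def)
      ultimately show ?thesis by (rule Qval_opt_dual_vertex) blast+
    qed
    then obtain \<rho>0 where \<rho>0: "\<And>s. s \<in> scens P d \<Longrightarrow> ?good s (\<rho>0 s)" by metis
    \<comment> \<open>Labels are extensional functions on the scenarios.\<close>
    define \<rho> where "\<rho> = restrict \<rho>0 (scens P d)"
    have \<rho>: "\<And>s. s \<in> scens P d \<Longrightarrow> ?good s (\<rho> s)" using \<rho>0 by (simp add: \<rho>_def)
    have vert: "\<rho> \<in> opt_vertices P d"
      using \<rho>0 by (auto simp: opt_vertices_def \<rho>_def)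
    have val: "Qexp P d x = ereal (opt_cut_val P d \<rho> x)"
      using \<rho> by (simp add: Qexp_def opt_cut_val_def)
    have "(d, \<rho>) \<notin> G"
      using master_sol_feasible(3)[OF sol, of "(d, \<rho>)"] less d(2) by (auto simp: C opt_cut_def val)
    then show ?thesis
      unfolding C using add_cut.optimality[OF d True less vert] \<rho> by blast
  qed
qed

lemma iterations_extend:
  assumes run: "iterations P Uf U n C x \<mu>" and sol: "master_sol P Uf U (C n) z m"
    and cut: "add_cut P (C n) z m D"
  shows "iterations P Uf U (Suc n) (C(Suc n := D)) (x(n := z)) (\<mu>(n := m))"
  using assms by (auto simp: iterations_def less_Suc_eq)

theorem theorem8:
  fixes P :: "('n1::finite, 'n2::finite, 'm2::finite, 'd, 's) sp"
    and Uf :: "'d \<Rightarrow> 's \<Rightarrow> real" and U :: real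
  assumes "sp_instance P"
    and "feas_bigM P Uf"
    and "opt_bigM P U"
    and "sp_feasible P"
    and "sp_bounded P"
  shows "(\<exists>N. \<forall>n C x \<mu>. iterations P Uf U n C x \<mu> \<longrightarrow> n \<le> N) \<and>
    (\<forall>n C x \<mu>. iterations P Uf U n C x \<mu> \<and> master_sol P Uf U (C n) (x n) (\<mu> n) \<and>
       stops P (x n) (\<mu> n) \<longrightarrow> sp_optimal P (x n)) \<and>
    (dual_pointed P \<longrightarrow>
      (\<forall>n C x \<mu>. iterations P Uf U n C x \<mu> \<and> master_sol P Uf U (C n) (x n) (\<mu> n) \<and>
         \<not> stops P (x n) (\<mu> n) \<longrightarrow> (\<exists>C'. add_cut P (C n) (x n) (\<mu> n) C'))) \<and>
    (dual_pointed P \<and> masters_solvable P Uf U \<longrightarrow>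
      (\<exists>n C x \<mu>. iterations P Uf U n C x \<mu> \<and> master_sol P Uf U (C n) (x n) (\<mu> n) \<and>
         stops P (x n) (\<mu> n) \<and> sp_optimal P (x n)))"
proof (intro conjI impI)
  let ?N = "card (feas_labels P) + card (opt_labels P)"
  have bound: "n \<le> ?N" if "iterations P Uf U n C x \<mu>" for n C x \<mu>
    using iterations_bounded[OF assms(1) that] .
  then show "\<exists>N. \<forall>n C x \<mu>. iterations P Uf U n C x \<mu> \<longrightarrow> n \<le> N" by blast
  have optimal: "sp_optimal P (x n)"
    if "iterations P Uf U n C x \<mu>" "master_sol P Uf U (C n) (x n) (\<mu> n)" "stops P (x n) (\<mu> n)"
    for n C x \<mu>
    using master_sol_stop_optimal[OF assms(1,2,3,5) _ _ that(2,3)]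
      iterations_cuts[OF assms(1) that(1) order_refl] by blast
  then show "\<forall>n C x \<mu>. iterations P Uf U n C x \<mu> \<and> master_sol P Uf U (C n) (x n) (\<mu> n) \<and>
       stops P (x n) (\<mu> n) \<longrightarrow> sp_optimal P (x n)" by blast
  show "\<forall>n C x \<mu>. iterations P Uf U n C x \<mu> \<and> master_sol P Uf U (C n) (x n) (\<mu> n) \<and>
         \<not> stops P (x n) (\<mu> n) \<longrightarrow> (\<exists>C'. add_cut P (C n) (x n) (\<mu> n) C')" if "dual_pointed P"
    using new_cut_exists[OF assms(1) that] by blast
  assume "dual_pointed P \<and> masters_solvable P Uf U"
  then have pointed: "dual_pointed P" and solvable: "masters_solvable P Uf U" by auto
  \<comment> \<open>In a run of greatest length the next master solution must stop the algorithm, since any further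
    cut would give a longer run.\<close>
  let ?run = "\<lambda>n. \<exists>C x \<mu>. iterations P Uf U n C x \<mu>"
  have less: "\<forall>k. ?run k \<longrightarrow> k < Suc ?N"
    using bound by (blast intro: le_imp_less_Suc)
  have "?run 0" by (auto simp: iterations_def)
  then obtain n where n: "?run n" "\<And>k. ?run k \<Longrightarrow> k \<le> n"
    using ex_has_greatest_nat[of ?run 0 "\<lambda>n. n", OF _ less] by blast
  then obtain C x \<mu> where run: "iterations P Uf U n C x \<mu>" by blast
  obtain z m where sol: "master_sol P Uf U (C n) z m"
    using solvable run unfolding masters_solvable_def by blast
  have stop: "stops P z m"
  proof (rule ccontr)
    assume "\<not> stops P z m"
    then obtain D where "add_cut P (C n) z m D"
      using new_cut_exists[OF assms(1) pointed sol] by blast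
    from n(2) iterations_extend[OF run sol this] have "Suc n \<le> n" by blast
    then show False by simp
  qed
  let ?x = "x(n := z)" and ?\<mu> = "\<mu>(n := m)"
  have run': "iterations P Uf U n C ?x ?\<mu>" using run by (auto simp: iterations_def)
  have "master_sol P Uf U (C n) (?x n) (?\<mu> n)" "stops P (?x n) (?\<mu> n)" using sol stop by auto
  with run' optimal[OF run' this] show "\<exists>n C x \<mu>. iterations P Uf U n C x \<mu> \<and>
      master_sol P Uf U (C n) (x n) (\<mu> n) \<and> stops P (x n) (\<mu> n) \<and> sp_optimal P (x n)" by blast
qed

end
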